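(* Let $\mathbf{J}\sim\mathcal{N}(\mu,C)$ be an isotropic Gaussian random function on $\mathbb{R}^d$. Then Random Function Descent (RFD) coincides with gradient descent with a specific step size: its iterates satisfy $$w_{n+1} = w_n - \eta_n^*\,\frac{\nabla\mathbf{J}(w_n)}{\|\nabla\mathbf{J}(w_n)\|},$$ where the RFD step sizes are given by $$\eta_n^* := \operatorname*{argmin}_{\eta\in\mathbb{R}}\ \frac{C\bigl(\frac{\eta^2}{2}\bigr)}{C(0)}\,(\mathbf{J}(w_n)-\mu) - \eta\,\frac{C'\bigl(\frac{\eta^2}{2}\bigr)}{C'(0)}\,\|\nabla\mathbf{J}(w_n)\|.$$
   Context: Notation: $\mathbf{J}\sim\mathcal{N}(\mu,C)$ means that $\mathbf{J}=(\mathbf{J}(w))_{w\in\mathbb{R}^d}$ is a Gaussian random function with constant mean $\mathbb{E}[\mathbf{J}(w)]=\mu\in\mathbb{R}$ and covariance $\operatorname{Cov}(\mathbf{J}(w),\mathbf{J}(\tilde w)) = C\bigl(\tfrac{\|w-\tilde w\|^2}{2}\bigr)$ for all $w,\tilde w\in\mathbb{R}^d$, where $C:\mathbb{R}\to\mathbb{R}$ (only its values on $[0,\infty)$ matter; $C'$ is its derivative there, one-sided at $0$). Standing assumptions: $\mathbf{J}$ is smooth enough that $\nabla\mathbf{J}$ exists and covariances involving derivatives of $\mathbf{J}$ are the corresponding derivatives of the covariance function; $C(0)>0$ and $C'(0)<0$. RFD selects $$w_{n+1} := \operatorname*{argmin}_{w}\ \mathbb{E}[\mathbf{J}(w)\mid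 \mathbf{J}(w_n),\nabla\mathbf{J}(w_n)],$$ starting from a deterministic $w_0\in\mathbb{R}^d$. Formally: for deterministic $w,\theta\in\mathbb{R}^d$ let $\varphi_{w,\theta}:\mathbb{R}\times\mathbb{R}^d\to\mathbb{R}$ be the continuous function with $\varphi_{w,\theta}(\mathbf{J}(w),\nabla\mathbf{J}(w))=\mathbb{E}[\mathbf{J}(\theta)\mid\mathbf{J}(w),\nabla\mathbf{J}(w)]$ almost surely, put $\Phi(w,j,g):=\operatorname{argmin}_\theta\varphi_{w,\theta}(j,g)$, and set $w_{n+1}:=\Phi(w_n,\mathbf{J}(w_n),\nabla\mathbf{J}(w_n))$ (the iterates are random variables plugged into the function $\Phi$ computed for deterministic arguments). Minimizers are treated as existing and being unique, and the gradient $\nabla\mathbf{J}(w_n)$ is nonzero at the iterates considered. *)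

theory Defs
  imports "HOL-Probability.Probability"
begin

text \<open>The Dirac case is allowed, as is needed for linear combinations of a Gaussian family.\<close>

definition gaussian_rv :: "'w measure \<Rightarrow> ('w \<Rightarrow> real) \<Rightarrow> bool" where
  "gaussian_rv M X \<longleftrightarrow> X \<in> borel_measurable M \<and>
     ((\<exists>m \<sigma>. \<sigma> > 0 \<and> distributed M lborel X (\<lambda>x. ennreal (normal_density m \<sigma> x))) \<or>
      (\<exists>m. AE \<omega> in M. X \<omega> = m))"

definition gaussian_process :: "'w measure \<Rightarrow> ('a \<Rightarrow> 'w \<Rightarrow> real) \<Rightarrow> bool" where
  "gaussian_process M J \<longleftrightarrow>
     (\<forall>I c. finite I \<longrightarrow> gaussian_rv M (\<lambda>\<omega>. \<Sum>x\<in>I. c x * J x \<omega>))"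

definition covariance :: "'w measure \<Rightarrow> ('w \<Rightarrow> real) \<Rightarrow> ('w \<Rightarrow> real) \<Rightarrow> real" where
  "covariance M X Y =
     (LINT \<omega>|M. (X \<omega> - (LINT \<omega>'|M. X \<omega>')) * (Y \<omega> - (LINT \<omega>'|M. Y \<omega>')))"

definition isotropic_gaussian ::
  "'w measure \<Rightarrow> ('a::euclidean_space \<Rightarrow> 'w \<Rightarrow> real) \<Rightarrow> real \<Rightarrow> (real \<Rightarrow> real) \<Rightarrow> bool" where
  "isotropic_gaussian M J \<mu> C \<longleftrightarrow>
     gaussian_process M J \<and>
     (\<forall>x. (LINT \<omega>|M. J x \<omega>) = \<mu>) \<and>
     (\<forall>x y. covariance M (J x) (J y) = C ((norm (x - y))\<^sup>2 / 2))"

text \<open>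
  \<open>G\<close> is the gradient field of \<open>J\<close>: almost every sample path of \<open>J\<close> is differentiable everywhere
  with gradient \<open>G\<close>, and the covariances involving directional derivatives of \<open>J\<close> are the
  corresponding derivatives of the covariance function. The square integrability of \<open>G x\<close> ensures
  that these covariances are not the default value of a non-existing integral.
\<close>

definition gradient_field ::
  "'w measure \<Rightarrow> ('a::euclidean_space \<Rightarrow> 'w \<Rightarrow> real) \<Rightarrow> ('a \<Rightarrow> 'w \<Rightarrow> 'a) \<Rightarrow> bool" where
  "gradient_field M J G \<longleftrightarrow>
     (AE \<omega> in M. \<forall>x. GDERIV (\<lambda>y. J y \<omega>) x :> G x \<omega>) \<and>
     (\<forall>x. G x \<in> borel_measurable M) \<and>
     (\<forall>x. integrable M (\<lambda>\<omega>. (norm (G x \<omega>))\<^sup>2)) \<and>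
     (\<forall>x y v. ((\<lambda>t. covariance M (J x) (J (y + t *\<^sub>R v))) has_real_derivative
                covariance M (J x) (\<lambda>\<omega>. G y \<omega> \<bullet> v)) (at 0)) \<and>
     (\<forall>x y u v. ((\<lambda>s. covariance M (J (x + s *\<^sub>R u)) (\<lambda>\<omega>. G y \<omega> \<bullet> v)) has_real_derivative
                covariance M (\<lambda>\<omega>. G x \<omega> \<bullet> u) (\<lambda>\<omega>. G y \<omega> \<bullet> v)) (at 0))"

text \<open>
  The function \<open>\<phi>\<^bsub>w,\<theta>\<^esub>\<close>: the continuous version of the factorized conditional expectation of
  \<open>J \<theta>\<close> given \<open>(J w, G w)\<close>, for deterministic \<open>w\<close> and \<open>\<theta>\<close>.
\<close>

definition cond_mean ::
  "'w measure \<Rightarrow> ('a::euclidean_space \<Rightarrow> 'w \<Rightarrow> real) \<Rightarrow> ('a \<Rightarrow> 'w \<Rightarrow> 'a) \<Rightarrow>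
   'a \<Rightarrow> 'a \<Rightarrow> real \<times> 'a \<Rightarrow> real" where
  "cond_mean M J G w \<theta> = (THE \<phi>. continuous_on UNIV \<phi> \<and>
     (AE \<omega> in M. \<phi> (J w \<omega>, G w \<omega>) =
        real_cond_exp M (vimage_algebra (space M) (\<lambda>\<omega>'. (J w \<omega>', G w \<omega>')) borel) (J \<theta>) \<omega>))"

definition rfd_step ::
  "'w measure \<Rightarrow> ('a::euclidean_space \<Rightarrow> 'w \<Rightarrow> real) \<Rightarrow> ('a \<Rightarrow> 'w \<Rightarrow> 'a) \<Rightarrow>
   'a \<Rightarrow> real \<Rightarrow> 'a \<Rightarrow> 'a" where
  "rfd_step M J G w j g = (ARG_MIN (\<lambda>\<theta>. cond_mean M J G w \<theta> (j, g)) \<theta>. True)"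

primrec rfd ::
  "'w measure \<Rightarrow> ('a::euclidean_space \<Rightarrow> 'w \<Rightarrow> real) \<Rightarrow> ('a \<Rightarrow> 'w \<Rightarrow> 'a) \<Rightarrow>
   'a \<Rightarrow> nat \<Rightarrow> 'w \<Rightarrow> 'a" where
  "rfd M J G w0 0 \<omega> = w0"
| "rfd M J G w0 (Suc n) \<omega> =
     rfd_step M J G (rfd M J G w0 n \<omega>) (J (rfd M J G w0 n \<omega>) \<omega>) (G (rfd M J G w0 n \<omega>) \<omega>)"

definition has_unique_minimizer :: "('b \<Rightarrow> real) \<Rightarrow> bool" where
  "has_unique_minimizer f \<longleftrightarrow> (\<exists>!x. is_arg_min f (\<lambda>_. True) x)"

definition rfd_objective ::
  "(real \<Rightarrow> real) \<Rightarrow> (real \<Rightarrow> real) \<Rightarrow> real \<Rightarrow> real \<Rightarrow> real \<Rightarrow> real \<Rightarrow> real" where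
  "rfd_objective C C' \<mu> j \<gamma> \<eta> =
     C (\<eta>\<^sup>2 / 2) / C 0 * (j - \<mu>) - \<eta> * (C' (\<eta>\<^sup>2 / 2) / C' 0) * \<gamma>"

end

theory Submission
  imports Defs "HOL-Real_Asymp.Real_Asymp"
begin

text \<open>
  The vector \<open>(J \<theta>, J w, G w)\<close> is Gaussian, so the conditional mean of \<open>J \<theta>\<close> given
  \<open>(J w, G w)\<close> is the best linear predictor. Isotropy makes this predictor explicit: \<open>J w\<close> is
  uncorrelated with \<open>G w\<close>, the covariance of \<open>G w\<close> is \<open>- C' 0\<close> times the identity, and with
  \<open>r = norm (\<theta> - w)\<close> the covariances of \<open>J \<theta>\<close> with \<open>J w\<close> and with \<open>v \<bullet> G w\<close> are \<open>C (r\<^sup>2 / 2)\<close> and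
  \<open>- C' (r\<^sup>2 / 2) * ((\<theta> - w) \<bullet> v)\<close>. Hence the conditional mean at \<open>(j, g)\<close> is
  \<open>\<mu> + C (r\<^sup>2 / 2) / C 0 * (j - \<mu>) + C' (r\<^sup>2 / 2) / C' 0 * ((\<theta> - w) \<bullet> g)\<close>
  (\<open>cond_mean_eq_regression\<close>). It depends on \<open>\<theta>\<close> only through \<open>r\<close> and \<open>(\<theta> - w) \<bullet> g\<close>, and is affine
  in the latter. By Cauchy--Schwarz one of the two points of the line through \<open>w\<close> in direction \<open>g\<close>
  at distance \<open>r\<close> is at least as good as \<open>\<theta>\<close>, so the unique minimizer lies on that line. There
  \<open>\<theta> = w - \<eta> g / norm g\<close> turns the conditional mean into the one-dimensional objective plus \<open>\<mu>\<close>
  (\<open>radial_minimizer_on_gradient_line\<close>).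

  The probabilistic part goes through characteristic functions. Joint Gaussianity is given for
  finite combinations of values of \<open>J\<close> only; \<open>v \<bullet> G w\<close> enters as an almost sure limit of difference
  quotients, and dominated convergence gives the characteristic function of
  \<open>a * J \<theta> + b * J w + v \<bullet> G w\<close> in closed form (\<open>joint_charfun\<close>). That function factors for the
  residual of \<open>J \<theta>\<close> and the observation \<open>(J w, G w)\<close>, which are therefore independent. This step
  rests on the uniqueness theorem for characteristic functions on Euclidean spaces
  (\<open>charfun_unique\<close>).

  The iterates use \<open>cond_mean\<close> at every argument, not only at almost every observed one. A continuous
  version is determined everywhere because the observation is an invertible affine image of a
  standard Gaussian vector, whose law charges every nonempty open set (\<open>std_gaussian_open_pos\<close>).
\<close>

section \<open>Characteristic functions determine laws on Euclidean spaces\<close>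

definition charfun :: "'b::euclidean_space measure \<Rightarrow> 'b \<Rightarrow> complex" where
  "charfun \<mu> u = (CLINT y|\<mu>. cis (u \<bullet> y))"

text \<open>
  Uniqueness is proved by approximation. Integrals of trigonometric polynomials are read off from the
  characteristic function. A polynomial in the sines \<open>sin (a * (y \<bullet> b))\<close> of the coordinates is
  such a trigonometric polynomial, and Weierstrass approximates every continuous function of the
  sines by polynomials uniformly on the whole space, since the sines stay in a fixed compact cube.
  Finally \<open>sin (a * t) / a\<close> tends to \<open>t\<close> as \<open>a\<close> tends to 0, which recovers all bounded continuous
  functions.
\<close>

inductive trig_poly :: "('b::euclidean_space \<Rightarrow> complex) \<Rightarrow> bool" where
  wave: "trig_poly (\<lambda>y. cis (u \<bullet> y))"
| add: "trig_poly f \<Longrightarrow> trig_poly g \<Longrightarrow> trig_poly (\<lambda>y. f y + g y)"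
| scale: "trig_poly f \<Longrightarrow> trig_poly (\<lambda>y. c * f y)"

lemma trig_poly_const: "trig_poly (\<lambda>y. c)"
  using trig_poly.scale[OF trig_poly.wave[of 0], of c] by simp

lemma trig_poly_wave_mult:
  assumes "trig_poly g"
  shows "trig_poly (\<lambda>y. cis (u \<bullet> y) * g y)"
  using assms
proof induction
  case (wave v)
  show ?case
    using trig_poly.wave[of "u + v"] by (simp add: cis_mult inner_add_left)
next
  case (add f g)
  then show ?case using trig_poly.add by (simp add: distrib_left)
next
  case (scale f c)
  then show ?case using trig_poly.scale[OF scale.IH, of c] by (simp add: mult.left_commute)
qed

lemma trig_poly_mult:
  assumes "trig_poly f" and "trig_poly g"
  shows "trig_poly (\<lambda>y. f y * g y)"
  using assms(1)
proof induction
  case (wave u)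
  show ?case by (rule trig_poly_wave_mult[OF assms(2)])
next
  case (add f1 f2)
  then show ?case using trig_poly.add by (simp add: distrib_right)
next
  case (scale f c)
  then show ?case using trig_poly.scale[OF scale.IH, of c] by (simp add: mult.assoc)
qed

lemma trig_poly_sum:
  assumes "finite I" and "\<And>i. i \<in> I \<Longrightarrow> trig_poly (f i)"
  shows "trig_poly (\<lambda>y. \<Sum>i\<in>I. f i y)"
  using assms by (induction I) (auto intro: trig_poly_const trig_poly.add)

lemma trig_poly_sin: "trig_poly (\<lambda>y. complex_of_real (sin (u \<bullet> y)))"
proof -
  have "trig_poly (\<lambda>y. (1 / (2 * \<i>)) * (cis (u \<bullet> y) + (-1) * cis ((-u) \<bullet> y)))"
    by (intro trig_poly.intros)
  moreover have "(1 / (2 * \<i>)) * (cis t + (-1) * cis (-t)) = complex_of_real (sin t)" for t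
    by (simp add: complex_eq_iff)
  ultimately show ?thesis by (simp add: inner_minus_left)
qed

definition sines :: "real \<Rightarrow> 'b::euclidean_space \<Rightarrow> 'b" where
  "sines a y = (\<Sum>b\<in>Basis. sin (a * (y \<bullet> b)) *\<^sub>R b)"

lemma sines_continuous: "continuous_on A (sines a)"
  unfolding sines_def by (intro continuous_intros)

lemma sines_bounded: "sines a y \<in> cbox (-One) One"
  by (auto simp: mem_box sines_def inner_sum_left inner_Basis if_distrib cong: if_cong)

lemma sines_limit: "(\<lambda>n. real (Suc n) *\<^sub>R sines (1 / real (Suc n)) y) \<longlonglongrightarrow> y"
proof -
  have "(\<lambda>n. real (Suc n) * sin (1 / real (Suc n) * t)) \<longlonglongrightarrow> t" for t :: real
    by real_asymp
  then have "(\<lambda>n. \<Sum>b\<in>Basis. (real (Suc n) * sin (1 / real (Suc n) * (y \<bullet> b))) *\<^sub>R b)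
      \<longlonglongrightarrow> (\<Sum>b\<in>Basis. (y \<bullet> b) *\<^sub>R b)"
    by (intro tendsto_intros) 
  then show ?thesis
    by (simp add: sines_def scaleR_sum_right euclidean_representation)
qed

lemma trig_poly_polynomial_sines:
  assumes "real_polynomial_function p"
  shows "trig_poly (\<lambda>y. complex_of_real (p (sines a y)))"
  using assms
proof induction
  case (linear h)
  then interpret bounded_linear h .
  have "complex_of_real (h (sines a y)) =
      (\<Sum>b\<in>Basis. complex_of_real (h b) * complex_of_real (sin ((a *\<^sub>R b) \<bullet> y)))" for y
    by (simp add: sines_def sum scaleR mult.commute inner_commute)
  then show ?case
    by (simp del: inner_scaleR_left) (intro trig_poly_sum trig_poly.scale trig_poly_sin finite_Basis)
next
  case (const c)
  show ?case by (rule trig_poly_const)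
next
  case (add f g)
  then show ?case using trig_poly.add by simp
next
  case (mult f g)
  then show ?case using trig_poly_mult by simp
qed

lemma integral_trig_poly_eq:
  fixes \<mu> \<nu> :: "'b::euclidean_space measure"
  assumes "prob_space \<mu>" "prob_space \<nu>"
    and [measurable_cong]: "sets \<mu> = sets borel" "sets \<nu> = sets borel"
    and eq: "\<And>u. charfun \<mu> u = charfun \<nu> u"
    and "trig_poly f"
  shows "integrable \<mu> f \<and> integrable \<nu> f \<and> integral\<^sup>L \<mu> f = integral\<^sup>L \<nu> f"
  using \<open>trig_poly f\<close>
proof induction
  case (wave u)
  interpret \<mu>: prob_space \<mu> by fact
  interpret \<nu>: prob_space \<nu> by fact
  have [measurable]: "(\<lambda>y. cis (u \<bullet> y)) \<in> borel_measurable borel"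
    by (intro borel_measurable_continuous_onI continuous_intros)
  have "integrable \<mu> (\<lambda>y. cis (u \<bullet> y))"
    by (rule \<mu>.integrable_const_bound[of _ 1]) auto
  moreover have "integrable \<nu> (\<lambda>y. cis (u \<bullet> y))"
    by (rule \<nu>.integrable_const_bound[of _ 1]) auto
  ultimately show ?case using eq[of u] by (simp add: charfun_def)
qed auto

lemma integral_continuous_sines_eq:
  fixes \<mu> \<nu> :: "'b::euclidean_space measure"
  assumes "prob_space \<mu>" "prob_space \<nu>"
    and [measurable_cong]: "sets \<mu> = sets borel" "sets \<nu> = sets borel"
    and eq: "\<And>u. charfun \<mu> u = charfun \<nu> u"
    and h: "continuous_on UNIV (h :: 'b \<Rightarrow> real)"
  shows "(LINT y|\<mu>. h (sines a y)) = (LINT y|\<nu>. h (sines a y))"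
proof -
  interpret \<mu>: prob_space \<mu> by fact
  interpret \<nu>: prob_space \<nu> by fact
  have [measurable]: "(\<lambda>y. h (sines a y)) \<in> borel_measurable borel"
    by (intro borel_measurable_continuous_onI continuous_on_compose2[OF h] sines_continuous) auto
  \<comment> \<open>Boundedness on the cube makes the composition with the sines bounded everywhere.\<close>
  have "compact (h ` cbox (-One) One)"
    by (intro compact_continuous_image continuous_on_subset[OF h]) auto
  then obtain B where B: "\<And>x. x \<in> cbox (-One) One \<Longrightarrow> \<bar>h x\<bar> \<le> B"
    by (metis bounded_iff compact_imp_bounded imageI real_norm_def)
  have int: "integrable \<mu> (\<lambda>y. h (sines a y))" "integrable \<nu> (\<lambda>y. h (sines a y))"
    using B[OF sines_bounded] 
    by (auto intro!: \<mu>.integrable_const_bound[of _ B] \<nu>.integrable_const_bound[of _ B])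
  have le: "\<bar>(LINT y|\<mu>. h (sines a y)) - (LINT y|\<nu>. h (sines a y))\<bar> \<le> 2 * e" if "e > 0" for e
  proof -
    obtain p where p: "real_polynomial_function p"
      and near: "\<And>x. x \<in> cbox (-One) One \<Longrightarrow> \<bar>h x - p x\<bar> < e"
      using Stone_Weierstrass_real_polynomial_function[OF compact_cbox continuous_on_subset[OF h] \<open>e > 0\<close>]
      by (metis subset_UNIV)
    have t: "integrable \<mu> (\<lambda>y. complex_of_real (p (sines a y)))"
        "integrable \<nu> (\<lambda>y. complex_of_real (p (sines a y)))"
        "(LINT y|\<mu>. complex_of_real (p (sines a y))) = (LINT y|\<nu>. complex_of_real (p (sines a y)))"
      using integral_trig_poly_eq[OF assms(1-5) trig_poly_polynomial_sines[OF p]] by auto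
    then have pint: "integrable \<mu> (\<lambda>y. p (sines a y))" "integrable \<nu> (\<lambda>y. p (sines a y))"
      by (simp_all add: complex_of_real_integrable_eq)
    have peq: "(LINT y|\<mu>. p (sines a y)) = (LINT y|\<nu>. p (sines a y))"
      using t(3) by simp
    have "\<bar>(LINT y|\<rho>. h (sines a y)) - (LINT y|\<rho>. p (sines a y))\<bar> \<le> e"
      if "prob_space \<rho>" "integrable \<rho> (\<lambda>y. h (sines a y))" "integrable \<rho> (\<lambda>y. p (sines a y))" for \<rho>
    proof -
      interpret \<rho>: prob_space \<rho> by fact
      have "\<bar>(LINT y|\<rho>. h (sines a y)) - (LINT y|\<rho>. p (sines a y))\<bar>
          = \<bar>LINT y|\<rho>. h (sines a y) - p (sines a y)\<bar>"
        using that by simp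
      also have "\<dots> \<le> (LINT y|\<rho>. \<bar>h (sines a y) - p (sines a y)\<bar>)"
        by (rule integral_abs_bound)
      also have "\<dots> \<le> (LINT y|\<rho>. e)"
        using near[OF sines_bounded] that by (intro integral_mono) (auto intro: less_imp_le)
      finally show ?thesis by (simp add: \<rho>.prob_space)
    qed
    from this[OF assms(1) int(1) pint(1)] this[OF assms(2) int(2) pint(2)] peq show ?thesis
      by linarith
  qed
  have "\<bar>(LINT y|\<mu>. h (sines a y)) - (LINT y|\<nu>. h (sines a y))\<bar> \<le> 0"
  proof (rule field_le_epsilon)
    fix e :: real assume "e > 0"
    then show "\<bar>(LINT y|\<mu>. h (sines a y)) - (LINT y|\<nu>. h (sines a y))\<bar> \<le> 0 + e"
      using le[of "e / 2"] by simp
  qed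
  then show ?thesis by simp
qed

text \<open>
  \<open>f\<close> is evaluated at the rescaled sines, which converge to the identity, and the bound on \<open>f\<close>
  allows dominated convergence.
\<close>

lemma integral_bounded_continuous_eq:
  fixes \<mu> \<nu> :: "'b::euclidean_space measure"
  assumes "prob_space \<mu>" "prob_space \<nu>"
    and [measurable_cong]: "sets \<mu> = sets borel" "sets \<nu> = sets borel"
    and eq: "\<And>u. charfun \<mu> u = charfun \<nu> u"
    and f: "continuous_on UNIV (f :: 'b \<Rightarrow> real)" and B: "\<And>y. \<bar>f y\<bar> \<le> B"
  shows "integral\<^sup>L \<mu> f = integral\<^sup>L \<nu> f"
proof -
  define g where "g n y = f (real (Suc n) *\<^sub>R sines (1 / real (Suc n)) y)" for n y
  have [measurable]: "f \<in> borel_measurable borel"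
    by (intro borel_measurable_continuous_onI f)
  have [measurable]: "g n \<in> borel_measurable borel" for n
    unfolding g_def
    by (intro borel_measurable_continuous_onI continuous_on_compose2[OF f] continuous_intros
        sines_continuous) auto
  have lim: "(\<lambda>n. g n y) \<longlonglongrightarrow> f y" for y
    unfolding g_def
    using f sines_limit[of y] by (metis UNIV_I continuous_on_eq_continuous_at isCont_tendsto_compose open_UNIV)
  have "(\<lambda>n. integral\<^sup>L \<rho> (g n)) \<longlonglongrightarrow> integral\<^sup>L \<rho> f"
    if "prob_space \<rho>" "sets \<rho> = sets borel" for \<rho>
  proof -
    interpret \<rho>: prob_space \<rho> by fact
    note that(2)[measurable_cong]
    show ?thesis
      using lim B by (intro integral_dominated_convergence[where w="\<lambda>_. B"]) (auto simp: g_def)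
  qed
  note lims = this[OF assms(1,3)] this[OF assms(2,4)]
  have "integral\<^sup>L \<mu> (g n) = integral\<^sup>L \<nu> (g n)" for n
    unfolding g_def
    by (rule integral_continuous_sines_eq[OF assms(1-5),
          where h="\<lambda>x. f (real (Suc n) *\<^sub>R x)"])
      (auto intro!: continuous_on_compose2[OF f] continuous_intros)
  with lims show ?thesis
    using LIMSEQ_unique by fastforce
qed

theorem charfun_unique:
  fixes \<mu> \<nu> :: "'b::euclidean_space measure"
  assumes "prob_space \<mu>" "prob_space \<nu>"
    and sets[measurable_cong]: "sets \<mu> = sets borel" "sets \<nu> = sets borel"
    and eq: "\<And>u. charfun \<mu> u = charfun \<nu> u"
  shows "\<mu> = \<nu>"
proof -
  interpret \<mu>: prob_space \<mu> by fact
  interpret \<nu>: prob_space \<nu> by fact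
  have closed_eq: "emeasure \<mu> F = emeasure \<nu> F" if "closed F" for F
  proof (cases "F = {}")
    case False
    \<comment> \<open>Bounded continuous functions that decrease to the indicator of the closed set.\<close>
    define g where "g n y = max 0 (1 - real n * infdist y F)" for n :: nat and y
    have cont: "continuous_on UNIV (g n)" for n
      unfolding g_def by (intro continuous_intros)
    have [measurable]: "g n \<in> borel_measurable borel" for n
      by (intro borel_measurable_continuous_onI cont)
    have bound: "\<bar>g n y\<bar> \<le> 1" for n y
      using infdist_nonneg[of y F] by (auto simp: g_def)
    have [measurable]: "F \<in> sets borel" using that by simp
    have lim: "(\<lambda>n. g n y) \<longlonglongrightarrow> indicator F y" for y
    proof (cases "y \<in> F")
      case True
      then show ?thesis by (simp add: g_def)
    next
      case out: False
      then have pos: "infdist y F > 0"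
        using that False by (metis in_closed_iff_infdist_zero infdist_nonneg less_eq_real_def)
      obtain N where N: "1 / infdist y F \<le> real N" using real_arch_simple by blast
      have "g n y = 0" if "n \<ge> N" for n
      proof -
        have "1 / infdist y F \<le> real n" using N that by linarith
        then show ?thesis using pos by (simp add: g_def field_simps)
      qed
      then have "\<forall>\<^sub>F n in sequentially. g n y = indicator F y"
        using out by (auto simp: eventually_sequentially)
      then show ?thesis by (rule tendsto_eventually)
    qed
    have "(\<lambda>n. integral\<^sup>L \<rho> (g n)) \<longlonglongrightarrow> measure \<rho> F"
      if "prob_space \<rho>" "sets \<rho> = sets borel" for \<rho>
    proof -
      interpret \<rho>: prob_space \<rho> by fact
      note that(2)[measurable_cong]
      have "(\<lambda>n. integral\<^sup>L \<rho> (g n)) \<longlonglongrightarrow> (LINT y|\<rho>. indicator F y)"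
        using lim bound by (intro integral_dominated_convergence[where w="\<lambda>_. 1"]) auto
      then show ?thesis using sets_eq_imp_space_eq[OF that(2)] by simp
    qed
    note lims = this[OF assms(1,3)] this[OF assms(2,4)]
    have "integral\<^sup>L \<mu> (g n) = integral\<^sup>L \<nu> (g n)" for n
      by (rule integral_bounded_continuous_eq[OF assms cont bound])
    with lims have "measure \<mu> F = measure \<nu> F"
      using LIMSEQ_unique by fastforce
    then show ?thesis
      by (simp add: \<mu>.emeasure_eq_measure \<nu>.emeasure_eq_measure)
  qed simp
  show ?thesis
  proof (rule measure_eqI_generator_eq[where E="Collect closed" and \<Omega>=UNIV and A="\<lambda>_. UNIV"])
    show "Int_stable (Collect (closed :: 'b set \<Rightarrow> bool))"
      by (auto simp: Int_stable_def)
  qed (auto simp: closed_eq sets borel_eq_closed)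
qed

section \<open>Independence and centred variables\<close>

lemma measurable_cis_inner [measurable]: "(\<lambda>y. cis (u \<bullet> y)) \<in> borel_measurable borel"
  by (intro borel_measurable_continuous_onI continuous_intros)

lemma charfun_distr:
  assumes [measurable]: "X \<in> borel_measurable M"
  shows "charfun (distr M borel X) u = (CLINT \<omega>|M. cis (u \<bullet> X \<omega>))"
  by (simp add: charfun_def integral_distr)

text \<open>
  Independence is phrased through laws because the two variables take values in different types.
  Both sides have the same characteristic function by Fubini's theorem.
\<close>

lemma (in prob_space) joint_law_eq_product_of_charfun_factors:
  fixes X :: "'a \<Rightarrow> 'b::euclidean_space" and Y :: "'a \<Rightarrow> 'c::euclidean_space"
  assumes [measurable]: "X \<in> borel_measurable M" "Y \<in> borel_measurable M"
    and factor: "\<And>u v. (CLINT \<omega>|M. cis (u \<bullet> X \<omega> + v \<bullet> Y \<omega>)) =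
      (CLINT \<omega>|M. cis (u \<bullet> X \<omega>)) * (CLINT \<omega>|M. cis (v \<bullet> Y \<omega>))"
  shows "distr M borel (\<lambda>\<omega>. (X \<omega>, Y \<omega>)) = distr M borel X \<Otimes>\<^sub>M distr M borel Y"
proof -
  let ?X = "distr M borel X" and ?Y = "distr M borel Y"
  interpret X: prob_space ?X by (rule prob_space_distr) simp
  interpret Y: prob_space ?Y by (rule prob_space_distr) simp
  interpret XY: pair_prob_space ?X ?Y ..
  show ?thesis
  proof (rule charfun_unique[symmetric])
    show "prob_space (?X \<Otimes>\<^sub>M ?Y)" by (rule XY.prob_space_axioms)
    show "prob_space (distr M borel (\<lambda>\<omega>. (X \<omega>, Y \<omega>)))" by (rule prob_space_distr) simp
    show "sets (?X \<Otimes>\<^sub>M ?Y) = sets borel"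
      by (simp add: borel_prod[symmetric] cong: sets_pair_measure_cong)
    fix w :: "'b \<times> 'c"
    obtain u v where w: "w = (u, v)" by force
    have split: "cis (w \<bullet> (x, y)) = cis (u \<bullet> x) * cis (v \<bullet> y)" for x y
      by (simp add: w cis_mult)
    have int: "integrable (?X \<Otimes>\<^sub>M ?Y) (\<lambda>(x, y). cis (u \<bullet> x) * cis (v \<bullet> y))"
      by (rule XY.integrable_const_bound[of _ 1]) (auto simp: norm_mult split_beta)
    have "charfun (?X \<Otimes>\<^sub>M ?Y) w =
        (CLINT z|?X \<Otimes>\<^sub>M ?Y. (case z of (x, y) \<Rightarrow> cis (u \<bullet> x) * cis (v \<bullet> y)))"
      by (simp add: charfun_def split split_beta) (metis prod.collapse split)
    also have "\<dots> = (CLINT x|?X. CLINT y|?Y. cis (u \<bullet> x) * cis (v \<bullet> y))"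
      using XY.integral_fst'[OF int] by simp
    also have "\<dots> = charfun ?X u * charfun ?Y v"
      by (simp add: charfun_def)
    also have "\<dots> = charfun (distr M borel (\<lambda>\<omega>. (X \<omega>, Y \<omega>))) w"
      by (simp add: charfun_distr factor w)
    finally show "charfun (?X \<Otimes>\<^sub>M ?Y) w = charfun (distr M borel (\<lambda>\<omega>. (X \<omega>, Y \<omega>))) w" .
  qed simp
qed

text \<open>
  Under the product law the integral is the expectation of \<open>X\<close> times the probability of \<open>B\<close>. In the
  application \<open>X\<close> is a regression residual and \<open>Y\<close> the observation.
\<close>

lemma (in prob_space) expectation_centred_indicator_eq_0:
  fixes X :: "'a \<Rightarrow> real" and Y :: "'a \<Rightarrow> 'c::euclidean_space"
  assumes [measurable]: "Y \<in> borel_measurable M" "B \<in> sets borel"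
    and X: "integrable M X" "expectation X = 0"
    and factor: "\<And>s v. (CLINT \<omega>|M. cis (s * X \<omega> + v \<bullet> Y \<omega>)) =
      (CLINT \<omega>|M. cis (s * X \<omega>)) * (CLINT \<omega>|M. cis (v \<bullet> Y \<omega>))"
  shows "(LINT \<omega>|M. X \<omega> * indicator B (Y \<omega>)) = 0"
proof -
  have [measurable]: "X \<in> borel_measurable M" using X(1) by simp
  let ?X = "distr M borel X" and ?Y = "distr M borel Y"
  interpret X: prob_space ?X by (rule prob_space_distr) simp
  interpret Y: prob_space ?Y by (rule prob_space_distr) simp
  interpret XY: pair_prob_space ?X ?Y ..
  have law: "distr M borel (\<lambda>\<omega>. (X \<omega>, Y \<omega>)) = ?X \<Otimes>\<^sub>M ?Y"
    by (rule joint_law_eq_product_of_charfun_factors) (simp_all add: factor)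
  let ?f = "\<lambda>z :: real \<times> 'c. fst z * indicator B (snd z) :: real"
  have f: "?f \<in> borel_measurable borel"
    unfolding borel_prod[symmetric] by measurable
  have "integrable M (\<lambda>\<omega>. indicator (Y -` B \<inter> space M) \<omega> *\<^sub>R X \<omega>)"
    by (intro integrable_mult_indicator X) measurable
  moreover have "integrable M (\<lambda>\<omega>. indicator (Y -` B \<inter> space M) \<omega> *\<^sub>R X \<omega>) \<longleftrightarrow>
      integrable M (\<lambda>\<omega>. ?f (X \<omega>, Y \<omega>))"
    by (rule Bochner_Integration.integrable_cong) (auto simp: indicator_def)
  ultimately have "integrable M (\<lambda>\<omega>. ?f (X \<omega>, Y \<omega>))" by blast
  then have int: "integrable (?X \<Otimes>\<^sub>M ?Y) (\<lambda>z. ?f z)"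
    unfolding law[symmetric] by (subst integrable_distr_eq) (auto simp: f)
  have "(LINT \<omega>|M. X \<omega> * indicator B (Y \<omega>)) = integral\<^sup>L (distr M borel (\<lambda>\<omega>. (X \<omega>, Y \<omega>))) ?f"
    by (subst integral_distr) (auto simp: f)
  also have "\<dots> = (LINT x|?X. LINT y|?Y. ?f (x, y))"
    unfolding law using XY.integral_fst'[OF int] by simp
  also have "\<dots> = (LINT x|?X. x) * (LINT y|?Y. indicator B y)"
    by simp
  also have "(LINT x|?X. x) = 0"
    using X(2) by (simp add: integral_distr)
  finally show ?thesis by simp
qed

text \<open>
  An even characteristic function means that \<open>X\<close> and \<open>- X\<close> have the same law, so their
  expectations agree. For a non-integrable \<open>X\<close> the expectation is 0 by convention.
\<close>

lemma (in prob_space) expectation_eq_0_of_charfun_even: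
  fixes X :: "'a \<Rightarrow> real"
  assumes "X \<in> borel_measurable M"
    and even: "\<And>s. (CLINT \<omega>|M. cis (s * X \<omega>)) = (CLINT \<omega>|M. cis (- s * X \<omega>))"
  shows "expectation X = 0"
proof -
  note assms(1)[measurable]
  have "distr M borel X = distr M borel (\<lambda>\<omega>. - X \<omega>)"
    by (rule charfun_unique) (use even in \<open>auto simp: charfun_distr prob_space_distr\<close>)
  then have "(LINT x|distr M borel X. x) = (LINT x|distr M borel (\<lambda>\<omega>. - X \<omega>). x)"
    by simp
  then show ?thesis by (simp add: integral_distr)
qed

section \<open>The support of a standard Gaussian vector\<close>

lemma charfun_std_normal: "(CLINT x|std_normal_distribution. cis (t * x)) = exp (- (t\<^sup>2) / 2)"
  using fun_cong[OF char_std_normal_distribution, of t]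
  by (simp add: char_def cis_conv_exp exp_of_real)

text \<open>
  A product law of the coordinates: its mass on boxes is a product of one-dimensional masses, so that
  positivity on open sets can be read off.
\<close>

definition std_gaussian :: "'b::euclidean_space measure" where
  "std_gaussian = distr (\<Pi>\<^sub>M b\<in>Basis. std_normal_distribution) borel (\<lambda>x. \<Sum>b\<in>Basis. x b *\<^sub>R b)"

lemma measurable_coordinates_sum [measurable]:
  "(\<lambda>x. \<Sum>b\<in>Basis. x b *\<^sub>R b) \<in> (\<Pi>\<^sub>M b\<in>(Basis :: 'b::euclidean_space set). std_normal_distribution) \<rightarrow>\<^sub>M borel"
  by (intro borel_measurable_sum borel_measurable_scaleR measurable_const)
    (auto intro: measurable_component_singleton[where M="\<lambda>_. std_normal_distribution", simplified])

lemma prob_space_std_normal: "prob_space std_normal_distribution"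
  by (rule prob_space_normal_density) simp

lemma finite_product_prob_space_std_normal:
  "finite_product_prob_space (\<lambda>_. std_normal_distribution) (Basis :: 'b::euclidean_space set)"
  by (intro finite_product_prob_space.intro
      product_prob_space.intro product_prob_space_axioms.intro product_sigma_finite.intro
      finite_product_sigma_finite.intro finite_product_sigma_finite_axioms.intro
      prob_space_std_normal prob_space_imp_sigma_finite finite_Basis)

lemma prob_space_std_gaussian: "prob_space std_gaussian"
proof -
  interpret std_normal_coords: finite_product_prob_space "\<lambda>_. std_normal_distribution" Basis
    by (rule finite_product_prob_space_std_normal)
  show ?thesis
    unfolding std_gaussian_def by (intro std_normal_coords.prob_space_distr measurable_coordinates_sum)
qed

lemma sets_std_gaussian [simp]: "sets std_gaussian = sets borel"
  by (simp add: std_gaussian_def)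

lemma charfun_std_gaussian:
  "charfun (std_gaussian :: 'b::euclidean_space measure) u = exp (- (norm u)\<^sup>2 / 2)"
proof -
  interpret std_normal: prob_space std_normal_distribution by (rule prob_space_std_normal)
  interpret std_normal_coords: finite_product_prob_space "\<lambda>_. std_normal_distribution" "Basis :: 'b set"
    by (rule finite_product_prob_space_std_normal)
  have "charfun (std_gaussian :: 'b measure) u =
      (CLINT x|\<Pi>\<^sub>M b\<in>Basis. std_normal_distribution. cis (u \<bullet> (\<Sum>b\<in>Basis. x b *\<^sub>R b)))"
    unfolding std_gaussian_def by (rule charfun_distr) simp
  also have "\<dots> = (CLINT x|\<Pi>\<^sub>M b\<in>Basis. std_normal_distribution. \<Prod>b\<in>Basis. cis ((u \<bullet> b) * x b))"
    by (simp add: cis_conv_exp inner_sum_right sum_distrib_left exp_sum mult.commute)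
  also have "\<dots> = (\<Prod>b\<in>Basis. CLINT x|std_normal_distribution. cis ((u \<bullet> b) * x))"
  proof (rule std_normal_coords.product_integral_prod)
    show "integrable std_normal_distribution (\<lambda>x. cis ((u \<bullet> b) * x))" for b
      using measurable_cis_inner[of "u \<bullet> b"]
      by (intro std_normal.integrable_const_bound[of _ 1]) auto
  qed simp
  also have "\<dots> = complex_of_real (\<Prod>b\<in>Basis. exp (- ((u \<bullet> b)\<^sup>2) / 2))"
    by (simp add: charfun_std_normal)
  also have "(\<Prod>b\<in>Basis. exp (- ((u \<bullet> b)\<^sup>2) / 2)) = exp (- (norm u)\<^sup>2 / 2)"
    by (simp add: exp_sum[symmetric] sum_negf sum_divide_distrib[symmetric] norm_eq_sqrt_inner
        euclidean_inner[of u u] power2_eq_square sum_nonneg)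
  finally show ?thesis .
qed

lemma std_normal_interval_pos:
  assumes "a < (b :: real)"
  shows "emeasure std_normal_distribution {a<..<b} > 0"
proof -
  have "\<not> (AE x in lborel. x \<notin> {a<..<b})"
  proof
    assume "AE x in lborel. x \<notin> {a<..<b}"
    then have "{a<..<b} \<in> null_sets lborel" by (subst AE_iff_null_sets) auto
    then show False using assms by (auto dest: null_setsD1)
  qed
  then have "\<not> (AE x in lborel. ennreal (std_normal_density x) * indicator {a<..<b} x = 0)"
    by (rule contrapos_nn) (auto elim!: eventually_mono simp: indicator_def normal_density_pos not_less
        less_imp_neq[OF normal_density_pos, symmetric] split: if_splits)
  then show ?thesis
    by (simp add: emeasure_density nn_integral_0_iff_AE zero_less_iff_neq_zero)
qed

lemma std_gaussian_open_pos:
  assumes "open (U :: 'b::euclidean_space set)" and "U \<noteq> {}"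
  shows "emeasure std_gaussian U > 0"
proof -
  interpret std_normal_coords: finite_product_prob_space "\<lambda>_. std_normal_distribution" "Basis :: 'b set"
    by (rule finite_product_prob_space_std_normal)
  obtain y where "y \<in> U" using assms by auto
  then obtain a b where y: "y \<in> box a b" and sub: "box a b \<subseteq> U"
    using open_contains_box[OF assms(1)] by metis
  let ?P = "\<Pi>\<^sub>M b\<in>(Basis :: 'b set). std_normal_distribution"
  let ?f = "\<lambda>x. \<Sum>b\<in>(Basis :: 'b set). x b *\<^sub>R b"
  let ?I = "\<lambda>i. {a \<bullet> i <..< b \<bullet> i}"
  have "0 < (\<Prod>i\<in>(Basis :: 'b set). emeasure std_normal_distribution (?I i))"
    using y by (auto simp: mem_box zero_less_iff_neq_zero intro!: std_normal_interval_pos[THEN less_imp_neq, symmetric])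
  also have "\<dots> = emeasure ?P (Pi\<^sub>E Basis ?I)"
    by (rule std_normal_coords.emeasure_PiM[symmetric]) simp_all
  also have "\<dots> \<le> emeasure ?P (?f -` U \<inter> space ?P)"
  proof (rule emeasure_mono)
    show "Pi\<^sub>E Basis ?I \<subseteq> ?f -` U \<inter> space ?P"
      by (auto intro!: subsetD[OF sub] simp: space_PiM mem_box PiE_iff)
    show "?f -` U \<inter> space ?P \<in> sets ?P"
      using assms(1) by (intro measurable_sets[OF measurable_coordinates_sum]) auto
  qed
  also have "\<dots> = emeasure std_gaussian U"
    unfolding std_gaussian_def using assms(1) by (simp add: emeasure_distr)
  finally show ?thesis .
qed

text \<open>
  The set where \<open>\<psi>\<close> does not vanish is open and has probability 0 under the standard Gaussian law,
  which leaves only the empty set.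
\<close>

lemma (in prob_space) AE_std_gaussian_continuous:
  fixes Z :: "'a \<Rightarrow> 'b::euclidean_space"
  assumes [measurable]: "Z \<in> borel_measurable M"
    and char: "\<And>u. (CLINT \<omega>|M. cis (u \<bullet> Z \<omega>)) = exp (- (norm u)\<^sup>2 / 2)"
    and \<psi>: "continuous_on UNIV (\<psi> :: 'b \<Rightarrow> real)"
    and AE: "AE \<omega> in M. \<psi> (Z \<omega>) = 0"
  shows "\<psi> z = 0"
proof (rule ccontr)
  assume nz: "\<psi> z \<noteq> 0"
  define U where "U = {x. \<psi> x \<noteq> 0}"
  have "open U"
    unfolding U_def using \<psi> by (intro open_Collect_neq continuous_intros)
  moreover have "U \<noteq> {}" using nz by (auto simp: U_def)
  ultimately have "emeasure std_gaussian U > 0" by (rule std_gaussian_open_pos)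
  moreover have "distr M borel Z = std_gaussian"
    by (rule charfun_unique)
      (auto simp: charfun_distr char charfun_std_gaussian prob_space_std_gaussian prob_space_distr)
  ultimately have pos: "emeasure M (Z -` U \<inter> space M) > 0"
    using \<open>open U\<close> by (metis (no_types) assms(1) borel_open emeasure_distr)
  have "emeasure M (Z -` U \<inter> space M) = 0"
  proof (rule emeasure_eq_0_AE[of "\<lambda>\<omega>. Z \<omega> \<in> U" M, THEN trans[rotated]])
    show "AE \<omega> in M. Z \<omega> \<notin> U" using AE by (simp add: U_def)
  qed (auto intro!: arg_cong[where f="emeasure M"])
  with pos show False by simp
qed

section \<open>Gaussian variables and finite combinations of the field\<close>

lemma (in prob_space) integrable_mult_of_square_integrable:
  fixes X Y :: "'a \<Rightarrow> real"
  assumes [measurable]: "X \<in> borel_measurable M" "Y \<in> borel_measurable M"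
    and "integrable M (\<lambda>\<omega>. (X \<omega>)\<^sup>2)" "integrable M (\<lambda>\<omega>. (Y \<omega>)\<^sup>2)"
  shows "integrable M (\<lambda>\<omega>. X \<omega> * Y \<omega>)"
proof (rule Bochner_Integration.integrable_bound)
  show "integrable M (\<lambda>\<omega>. (X \<omega>)\<^sup>2 + (Y \<omega>)\<^sup>2)" using assms by simp
  have "\<bar>x * y\<bar> \<le> x\<^sup>2 + y\<^sup>2" for x y :: real
  proof -
    have "2 * (\<bar>x\<bar> * \<bar>y\<bar>) \<le> \<bar>x\<bar>\<^sup>2 + \<bar>y\<bar>\<^sup>2"
      using sum_squares_bound[of "\<bar>x\<bar>" "\<bar>y\<bar>"] by (simp add: mult.assoc)
    then show ?thesis by (simp add: abs_mult) (smt (verit) mult_nonneg_nonneg abs_ge_zero)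
  qed
  then show "AE \<omega> in M. norm (X \<omega> * Y \<omega>) \<le> norm ((X \<omega>)\<^sup>2 + (Y \<omega>)\<^sup>2)"
    by simp
qed simp

lemma (in prob_space) gaussian_rv_square_integrable:
  assumes "gaussian_rv M X"
  shows "integrable M X" and "integrable M (\<lambda>\<omega>. (X \<omega>)\<^sup>2)"
proof -
  have [measurable]: "X \<in> borel_measurable M" using assms by (simp add: gaussian_rv_def)
  have "integrable M X \<and> integrable M (\<lambda>\<omega>. (X \<omega>)\<^sup>2)"
    using assms unfolding gaussian_rv_def
  proof (elim conjE disjE exE)
    fix m \<sigma> :: real
    assume \<sigma>: "\<sigma> > 0" and D: "distributed M lborel X (\<lambda>x. ennreal (normal_density m \<sigma> x))"
    have 1: "integrable M X"
      using integrable_normal_moment_nz_1[OF \<sigma>, of m] distributed_integrable[OF D, of "\<lambda>x. x"] by simp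
    have 2: "integrable M (\<lambda>\<omega>. (X \<omega> - m)\<^sup>2)"
      using integrable_normal_moment[OF \<sigma>, of m 2] distributed_integrable[OF D, of "\<lambda>x. (x - m)\<^sup>2"]
      by simp
    have "integrable M (\<lambda>\<omega>. (X \<omega> - m)\<^sup>2 + 2 * m * X \<omega> - m\<^sup>2)"
      using 1 2 by simp
    then have "integrable M (\<lambda>\<omega>. (X \<omega>)\<^sup>2)"
      by (rule Bochner_Integration.integrable_cong[THEN iffD1, rotated 2])
        (auto simp: power2_eq_square algebra_simps)
    with 1 show ?thesis ..
  next
    fix m assume "AE \<omega> in M. X \<omega> = m"
    then have "integrable M X" "integrable M (\<lambda>\<omega>. (X \<omega>)\<^sup>2)"
      by (auto intro: integrable_const_bound[of _ "\<bar>m\<bar>"] integrable_const_bound[of _ "m\<^sup>2"])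
    then show ?thesis ..
  qed
  then show "integrable M X" and "integrable M (\<lambda>\<omega>. (X \<omega>)\<^sup>2)" by auto
qed

lemma (in prob_space) gaussian_rv_charfun:
  assumes X: "gaussian_rv M X"
  shows "(CLINT \<omega>|M. cis (X \<omega>)) = cis (expectation X) * exp (- covariance M X X / 2)"
  using X unfolding gaussian_rv_def
proof (elim conjE disjE exE)
  fix m \<sigma> :: real
  assume [measurable]: "X \<in> borel_measurable M"
    and \<sigma>: "\<sigma> > 0" and D: "distributed M lborel X (\<lambda>x. ennreal (normal_density m \<sigma> x))"
  let ?Z = "\<lambda>\<omega>. (X \<omega> - m) / \<sigma>"
  have "distributed M lborel ?Z std_normal_density"
    using D normal_standard_normal_convert[OF \<sigma>] by simp
  then have "distr M lborel ?Z = std_normal_distribution"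
    by (rule distributed_distr_eq_density)
  then have Z: "distr M borel ?Z = std_normal_distribution"
    by (simp cong: distr_cong)
  have mean: "expectation X = m" and var: "covariance M X X = \<sigma>\<^sup>2"
    using normal_distributed_expectation[OF \<sigma> D] normal_distributed_variance[OF \<sigma> D]
    by (simp_all add: covariance_def power2_eq_square)
  have "(CLINT \<omega>|M. cis (X \<omega>)) = (CLINT \<omega>|M. cis m * cis (\<sigma> \<bullet> ?Z \<omega>))"
    using \<sigma> by (simp add: cis_mult)
  also have "\<dots> = cis m * (CLINT \<omega>|M. cis (\<sigma> \<bullet> ?Z \<omega>))"
    by (rule integral_mult_right_zero)
  also have "(CLINT \<omega>|M. cis (\<sigma> \<bullet> ?Z \<omega>)) = exp (- (\<sigma>\<^sup>2) / 2)"
    by (subst charfun_distr[symmetric])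
      (simp_all only: Z charfun_def inner_real_def charfun_std_normal, simp)
  finally show ?thesis by (simp add: mean var)
next
  fix m assume [measurable]: "X \<in> borel_measurable M" and AE: "AE \<omega> in M. X \<omega> = m"
  have 1: "expectation X = (LINT \<omega>|M. m)" using AE by (intro integral_cong_AE) auto
  have 2: "covariance M X X = (LINT \<omega>|M. 0)"
    unfolding covariance_def 1 using AE
    by (intro integral_cong_AE) (auto simp: prob_space elim!: eventually_mono)
  have "(\<lambda>\<omega>. cis (1 \<bullet> X \<omega>)) \<in> borel_measurable M" by measurable
  then have "(CLINT \<omega>|M. cis (X \<omega>)) = (CLINT \<omega>|M. cis m)"
    using AE by (intro integral_cong_AE) (auto elim!: eventually_mono)
  with 1 2 show ?thesis by (simp add: prob_space)
qed

text \<open>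
  The points \<open>p i\<close> need not be distinct, whereas Gaussian processes are defined by sums over sets of
  points; equal points are therefore merged first. Repetitions occur in \<open>joint_charfun\<close>, where
  \<open>\<theta>\<close> may equal \<open>w\<close>.
\<close>

lemma (in prob_space) isotropic_combination_charfun:
  assumes iso: "isotropic_gaussian M J \<mu> C" and A: "finite A"
  shows "(CLINT \<omega>|M. cis (\<Sum>i\<in>A. c i * J (p i) \<omega>)) =
    cis (\<mu> * (\<Sum>i\<in>A. c i)) *
    exp (- (\<Sum>i\<in>A. \<Sum>k\<in>A. c i * c k * C ((norm (p i - p k))\<^sup>2 / 2)) / 2)"
proof -
  have gp: "gaussian_process M J" and mean: "\<And>x. expectation (J x) = \<mu>"
    and cov: "\<And>x y. covariance M (J x) (J y) = C ((norm (x - y))\<^sup>2 / 2)"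
    using iso by (auto simp: isotropic_gaussian_def)
  have J: "gaussian_rv M (J x)" for x
    using gp[unfolded gaussian_process_def, rule_format, of "{x}" "\<lambda>_. 1"] by simp
  then have [measurable]: "J x \<in> borel_measurable M" for x
    by (simp add: gaussian_rv_def)
  note J_int = gaussian_rv_square_integrable[OF J]
  have dev: "integrable M (\<lambda>\<omega>. (J x \<omega> - \<mu>)\<^sup>2)" for x
    using J_int[of x] by (simp add: power2_diff)
  have prod_int: "integrable M (\<lambda>\<omega>. (J x \<omega> - \<mu>) * (J y \<omega> - \<mu>))" for x y
    by (rule integrable_mult_of_square_integrable) (use dev in auto)
  define X where "X \<omega> = (\<Sum>i\<in>A. c i * J (p i) \<omega>)" for \<omega>
  have X_eq: "X = (\<lambda>\<omega>. \<Sum>x\<in>p ` A. (\<Sum>i\<in>{i \<in> A. p i = x}. c i) * J x \<omega>)"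
  proof
    fix \<omega>
    have "X \<omega> = (\<Sum>x\<in>p ` A. \<Sum>i\<in>{i \<in> A. p i = x}. c i * J (p i) \<omega>)"
      unfolding X_def by (rule sum.image_gen[OF A])
    also have "\<dots> = (\<Sum>x\<in>p ` A. (\<Sum>i\<in>{i \<in> A. p i = x}. c i) * J x \<omega>)"
      by (simp add: sum_distrib_right)
    finally show "X \<omega> = (\<Sum>x\<in>p ` A. (\<Sum>i\<in>{i \<in> A. p i = x}. c i) * J x \<omega>)" .
  qed
  have gX: "gaussian_rv M X"
    unfolding X_eq using gp A by (simp add: gaussian_process_def)
  have EX: "expectation X = \<mu> * (\<Sum>i\<in>A. c i)"
    using J_int by (simp add: X_def[abs_def] mean sum_distrib_left mult.commute)
  have dX: "X \<omega> - expectation X = (\<Sum>i\<in>A. c i * (J (p i) \<omega> - \<mu>))" for \<omega>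
    unfolding EX by (simp add: X_def sum_distrib_left sum_subtractf[symmetric] algebra_simps)
  have "covariance M X X =
      (LINT \<omega>|M. (\<Sum>i\<in>A. \<Sum>k\<in>A. (c i * c k) * ((J (p i) \<omega> - \<mu>) * (J (p k) \<omega> - \<mu>))))"
    unfolding covariance_def dX sum_product by (simp add: mult_ac)
  also have "\<dots> = (\<Sum>i\<in>A. \<Sum>k\<in>A. (c i * c k) *
      (LINT \<omega>|M. (J (p i) \<omega> - \<mu>) * (J (p k) \<omega> - \<mu>)))"
    using prod_int by simp
  also have "\<dots> = (\<Sum>i\<in>A. \<Sum>k\<in>A. c i * c k * C ((norm (p i - p k))\<^sup>2 / 2))"
    using cov by (simp add: covariance_def mean)
  finally show ?thesis
    using gaussian_rv_charfun[OF gX] by (simp add: EX X_def)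
qed

section \<open>The joint law of the field and its gradient\<close>

text \<open>
  The left-hand side is the variance of \<open>a * J \<theta> + b * J w + (J (w + h *\<^sub>R v) - J w) / h\<close> as a double
  sum over three points, with \<open>K\<close>, \<open>A\<close>, \<open>B\<close>, \<open>D\<close> the values of the covariance function at the
  occurring distances. The right-hand side groups it into terms with a limit as \<open>h\<close> tends to 0.
\<close>

lemma second_difference_expansion:
  fixes a b h K A B D :: real
  assumes "h \<noteq> 0"
  shows "a * a * K + (a * (b - 1 / h) * A + a * (1 / h) * B)
    + ((b - 1 / h) * a * A + ((b - 1 / h) * (b - 1 / h) * K + (b - 1 / h) * (1 / h) * D)
    + (1 / h * a * B + (1 / h * (b - 1 / h) * D + 1 / h * (1 / h) * K))) =
    a\<^sup>2 * K + b\<^sup>2 * K + 2 * a * b * A + 2 * a * ((B - A) / h)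
      + 2 * b * h * ((D - K) / h\<^sup>2) - 2 * ((D - K) / h\<^sup>2)"
proof -
  define i where "i = 1 / h"
  have *: "x / h = x * i" "x / h\<^sup>2 = x * (i * i)" for x by (simp_all add: i_def power2_eq_square)
  have hi: "2 * b * h * ((D - K) * (i * i)) = 2 * b * (D - K) * i"
    using assms by (simp add: i_def)
  show ?thesis unfolding * hi by (simp add: power2_eq_square algebra_simps)
qed

locale isotropic_gradient_model = prob_space M for M :: "'w measure" +
  fixes J :: "'a::euclidean_space \<Rightarrow> 'w \<Rightarrow> real"
    and G :: "'a \<Rightarrow> 'w \<Rightarrow> 'a"
    and \<mu> :: real
    and C C' :: "real \<Rightarrow> real"
  assumes iso: "isotropic_gaussian M J \<mu> C"
    and grad: "gradient_field M J G"
    and C_deriv: "\<And>r. r \<ge> 0 \<Longrightarrow> (C has_real_derivative C' r) (at r within {0..})"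
    and C0_pos: "C 0 > 0"
    and C'0_neg: "C' 0 < 0"
begin

lemma J_integrable: "integrable M (J x)"
proof -
  have "gaussian_rv M (J x)"
    using iso[unfolded isotropic_gaussian_def gaussian_process_def, THEN conjunct1, rule_format, of "{x}" "\<lambda>_. 1"]
    by simp
  then show ?thesis by (rule gaussian_rv_square_integrable)
qed

lemma J_measurable [measurable]: "J x \<in> borel_measurable M"
  using J_integrable by (rule borel_measurable_integrable)

lemma G_measurable [measurable]: "G x \<in> borel_measurable M"
  using grad by (simp add: gradient_field_def)

lemma G_inner_integrable: "integrable M (\<lambda>\<omega>. v \<bullet> G x \<omega>)"
proof (rule Bochner_Integration.integrable_bound)
  show "integrable M (\<lambda>\<omega>. norm v * (1 + (norm (G x \<omega>))\<^sup>2))"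
    using grad by (simp add: gradient_field_def)
  have "\<bar>v \<bullet> g\<bar> \<le> norm v * (1 + (norm g)\<^sup>2)" for g :: 'a
  proof -
    have "\<bar>v \<bullet> g\<bar> \<le> norm v * norm g" by (rule Cauchy_Schwarz_ineq2)
    also have "norm g \<le> 1 + (norm g)\<^sup>2"
      using sum_squares_bound[of 1 "norm g"] by (simp add: power2_eq_square)
        (smt (verit) norm_ge_zero zero_le_square)
    finally show ?thesis by (simp add: mult_left_mono)
  qed
  then show "AE \<omega> in M. norm (v \<bullet> G x \<omega>) \<le> norm (norm v * (1 + (norm (G x \<omega>))\<^sup>2))"
    by (simp add: abs_mult abs_of_nonneg)
qed simp

text \<open>
  The inner function takes values in \<open>{0..}\<close>, so the chain rule works with the one-sided derivative
  of \<open>C\<close>, and the point \<open>z = 0\<close> needs no separate treatment.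
\<close>

lemma covariance_function_directional_derivative:
  "((\<lambda>t. C ((norm (z - t *\<^sub>R v))\<^sup>2 / 2)) has_real_derivative
     - (C' ((norm z)\<^sup>2 / 2) * (z \<bullet> v))) (at 0)"
proof -
  let ?q = "\<lambda>t. (norm (z - t *\<^sub>R v))\<^sup>2 / 2"
  have q: "?q = (\<lambda>t. ((norm z)\<^sup>2 - 2 * t * (z \<bullet> v) + t\<^sup>2 * (norm v)\<^sup>2) / 2)"
    unfolding fun_eq_iff power2_norm_eq_inner
    by (simp add: inner_diff_left inner_diff_right inner_commute power2_eq_square algebra_simps)
  have "(?q has_real_derivative - (z \<bullet> v)) (at 0)"
    unfolding q by (auto intro!: derivative_eq_intros)
  then have "((\<lambda>t. C (?q t)) has_real_derivative C' ((norm z)\<^sup>2 / 2) * (- (z \<bullet> v))) (at 0)"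
    using C_deriv[of "(norm z)\<^sup>2 / 2"]
    by (intro DERIV_image_chain[unfolded o_def] has_field_derivative_subset[where t="{0..}"])
      (auto intro: has_field_derivative_subset)
  then show ?thesis by simp
qed

text \<open>
  Difference quotients are taken along one null sequence because dominated convergence is applied to
  sequences of integrands.
\<close>

definition mesh :: "nat \<Rightarrow> real" where "mesh n = inverse (real (Suc n))"

lemma mesh_pos: "mesh n > 0" by (simp add: mesh_def)

lemma mesh_tendsto_0: "mesh \<longlonglongrightarrow> 0"
  unfolding mesh_def[abs_def] by (rule LIMSEQ_inverse_real_of_nat)

lemma mesh_at_0: "filterlim mesh (at 0) sequentially"
  using mesh_tendsto_0 mesh_pos by (auto simp: filterlim_at less_imp_neq[symmetric])

lemma difference_quotient_tendsto:
  assumes "(f has_real_derivative D) (at 0)"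
  shows "(\<lambda>n. (f (mesh n) - f 0) / mesh n) \<longlonglongrightarrow> D"
  using filterlim_compose[OF assms[unfolded DERIV_def] mesh_at_0] by simp

text \<open>
  Up to the factor \<open>- 2\<close> this is the variance of the difference quotient of \<open>J\<close>. It converges although
  \<open>C\<close> is differentiated only once, because its argument is quadratic in the step.
\<close>

lemma covariance_function_second_difference:
  "(\<lambda>n. (C ((norm (mesh n *\<^sub>R v))\<^sup>2 / 2) - C 0) / (mesh n)\<^sup>2) \<longlonglongrightarrow> C' 0 * (norm v)\<^sup>2 / 2"
proof (cases "v = 0")
  case False
  define q where "q n = (norm (mesh n *\<^sub>R v))\<^sup>2 / 2" for n
  have q: "q n = (mesh n)\<^sup>2 * ((norm v)\<^sup>2 / 2)" for n
    by (simp add: q_def power_mult_distrib)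
  have "q \<longlonglongrightarrow> 0\<^sup>2 * ((norm v)\<^sup>2 / 2)"
    unfolding q[abs_def] by (intro tendsto_intros mesh_tendsto_0)
  moreover have pos: "q n > 0" for n using False mesh_pos[of n] by (simp add: q)
  ultimately have "filterlim q (at 0 within {0..}) sequentially"
    by (auto simp: filterlim_at less_imp_le intro!: always_eventually less_imp_neq[symmetric])
  moreover have "((\<lambda>r. (C r - C 0) / (r - 0)) \<longlongrightarrow> C' 0) (at 0 within {0..})"
    using C_deriv[of 0] unfolding has_field_derivative_iff by simp
  ultimately have "(\<lambda>n. (C (q n) - C 0) / (q n - 0)) \<longlonglongrightarrow> C' 0"
    by (rule filterlim_compose[rotated])
  then have "(\<lambda>n. (C (q n) - C 0) / (q n - 0) * ((norm v)\<^sup>2 / 2)) \<longlonglongrightarrow> C' 0 * ((norm v)\<^sup>2 / 2)"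
    by (intro tendsto_intros)
  moreover have "(C (q n) - C 0) / (q n - 0) * ((norm v)\<^sup>2 / 2) = (C (q n) - C 0) / (mesh n)\<^sup>2" for n
  proof -
    have "x / (s * k) * k = x / s" if "k \<noteq> 0" for x s k :: real
      using that by simp
    from this[of "(norm v)\<^sup>2 / 2" "C (q n) - C 0" "(mesh n)\<^sup>2"] show ?thesis
      using False unfolding q diff_zero by simp
  qed
  ultimately show ?thesis by (simp add: q_def)
qed simp

lemma AE_difference_quotient_gradient:
  "AE \<omega> in M. \<forall>w v. (\<lambda>n. (J (w + mesh n *\<^sub>R v) \<omega> - J w \<omega>) / mesh n) \<longlonglongrightarrow> v \<bullet> G w \<omega>"
proof -
  have "AE \<omega> in M. \<forall>x. GDERIV (\<lambda>y. J y \<omega>) x :> G x \<omega>"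
    using grad by (simp add: gradient_field_def)
  then show ?thesis
  proof eventually_elim
    case (elim \<omega>)
    show ?case
    proof (intro allI)
      fix w v
      have "((\<lambda>y. J y \<omega>) has_derivative (\<lambda>h. h \<bullet> G w \<omega>)) (at (w + 0 *\<^sub>R v))"
        using elim by (simp add: gderiv_def)
      moreover have "((\<lambda>t. w + t *\<^sub>R v) has_derivative (\<lambda>t. t *\<^sub>R v)) (at (0 :: real))"
        by (auto intro!: derivative_eq_intros)
      ultimately have "((\<lambda>t. J (w + t *\<^sub>R v) \<omega>) has_derivative (\<lambda>t. (t *\<^sub>R v) \<bullet> G w \<omega>)) (at 0)"
        by (rule has_derivative_compose[rotated])
      then have "((\<lambda>t. J (w + t *\<^sub>R v) \<omega>) has_real_derivative v \<bullet> G w \<omega>) (at 0)"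
        by (simp add: has_field_derivative_def mult_commute_abs)
      from difference_quotient_tendsto[OF this]
      show "(\<lambda>n. (J (w + mesh n *\<^sub>R v) \<omega> - J w \<omega>) / mesh n) \<longlonglongrightarrow> v \<bullet> G w \<omega>" by simp
    qed
  qed
qed

text \<open>
  The variance of \<open>a * J \<theta> + b * J w + v \<bullet> G w\<close> with \<open>z = \<theta> - w\<close>.
\<close>

definition combination_variance :: "'a \<Rightarrow> real \<Rightarrow> real \<Rightarrow> 'a \<Rightarrow> real" where
  "combination_variance z a b v = a\<^sup>2 * C 0 + b\<^sup>2 * C 0 + 2 * a * b * C ((norm z)\<^sup>2 / 2)
     - 2 * a * C' ((norm z)\<^sup>2 / 2) * (z \<bullet> v) - C' 0 * (norm v)\<^sup>2"

text \<open>
  With \<open>v \<bullet> G w\<close> replaced by the difference quotient of \<open>J\<close> at \<open>w\<close> in direction \<open>v\<close>, the combination is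
  Gaussian with mean \<open>\<mu> * (a + b)\<close>, and its variances converge by the two limits proved above
  for \<open>C\<close>. Characteristic functions pass to the almost sure limit.
\<close>

lemma joint_charfun:
  "(CLINT \<omega>|M. cis (a * J \<theta> \<omega> + b * J w \<omega> + v \<bullet> G w \<omega>)) =
     cis (\<mu> * (a + b)) * exp (- combination_variance (\<theta> - w) a b v / 2)"
proof -
  let ?z = "\<theta> - w"
  define X where "X n \<omega> = a * J \<theta> \<omega> + b * J w \<omega> + (J (w + mesh n *\<^sub>R v) \<omega> - J w \<omega>) / mesh n" for n \<omega>
  have [measurable]: "X n \<in> borel_measurable M" for n
    unfolding X_def by measurable
  define V where "V n = a\<^sup>2 * C 0 + b\<^sup>2 * C 0 + 2 * a * b * C ((norm ?z)\<^sup>2 / 2)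
     + 2 * a * ((C ((norm (?z - mesh n *\<^sub>R v))\<^sup>2 / 2) - C ((norm ?z)\<^sup>2 / 2)) / mesh n)
     + 2 * b * mesh n * ((C ((norm (mesh n *\<^sub>R v))\<^sup>2 / 2) - C 0) / (mesh n)\<^sup>2)
     - 2 * ((C ((norm (mesh n *\<^sub>R v))\<^sup>2 / 2) - C 0) / (mesh n)\<^sup>2)" for n
  have "V \<longlonglongrightarrow> a\<^sup>2 * C 0 + b\<^sup>2 * C 0 + 2 * a * b * C ((norm ?z)\<^sup>2 / 2)
     + 2 * a * (- (C' ((norm ?z)\<^sup>2 / 2) * (?z \<bullet> v)))
     + 2 * b * 0 * (C' 0 * (norm v)\<^sup>2 / 2) - 2 * (C' 0 * (norm v)\<^sup>2 / 2)"
    unfolding V_def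
    using difference_quotient_tendsto[OF covariance_function_directional_derivative[of ?z v]]
    by (intro tendsto_intros mesh_tendsto_0 covariance_function_second_difference) simp_all
  then have V_lim: "V \<longlonglongrightarrow> combination_variance ?z a b v"
    by (simp add: combination_variance_def algebra_simps)
  have X_char: "(CLINT \<omega>|M. cis (X n \<omega>)) = cis (\<mu> * (a + b)) * exp (- V n / 2)" for n
  proof -
    \<comment> \<open>The points and coefficients that write the approximating variable as a combination of field values.\<close>
    define p where "p i = (if i = 0 then \<theta> else if i = 1 then w else w + mesh n *\<^sub>R v)" for i :: nat
    define c where "c i = (if i = 0 then a else if i = 1 then b - 1 / mesh n else 1 / mesh n)" for i :: nat
    let ?A = "{0, 1, 2 :: nat}"
    have nz: "mesh n \<noteq> 0" using mesh_pos[of n] by simp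
    have 1: "(\<Sum>i\<in>?A. c i * J (p i) \<omega>) = X n \<omega>" for \<omega>
      using nz by (simp add: c_def p_def X_def field_simps)
    have 2: "(\<Sum>i\<in>?A. c i) = a + b"
      by (simp add: c_def)
    have [simp]: "norm (w - \<theta>) = norm ?z" "norm (w + mesh n *\<^sub>R v - \<theta>) = norm (?z - mesh n *\<^sub>R v)"
      "\<theta> - (w + mesh n *\<^sub>R v) = ?z - mesh n *\<^sub>R v" "norm (w - (w + mesh n *\<^sub>R v)) = norm (mesh n *\<^sub>R v)"
      by (auto simp: norm_minus_commute algebra_simps)
    have "(\<Sum>i\<in>?A. \<Sum>k\<in>?A. c i * c k * C ((norm (p i - p k))\<^sup>2 / 2)) = V n"
      unfolding V_def second_difference_expansion[OF nz, symmetric]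
      by (simp add: c_def p_def del: norm_scaleR)
    then show ?thesis
      using isotropic_combination_charfun[OF iso, of ?A c p] by (simp only: 1 2) simp
  qed
  have "(\<lambda>n. CLINT \<omega>|M. cis (X n \<omega>)) \<longlonglongrightarrow> (CLINT \<omega>|M. cis (a * J \<theta> \<omega> + b * J w \<omega> + v \<bullet> G w \<omega>))"
  proof (rule integral_dominated_convergence[where w="\<lambda>_. 1"])
    show "AE \<omega> in M. (\<lambda>n. cis (X n \<omega>)) \<longlonglongrightarrow> cis (a * J \<theta> \<omega> + b * J w \<omega> + v \<bullet> G w \<omega>)"
      using AE_difference_quotient_gradient
      by eventually_elim
        (auto simp: X_def intro!: tendsto_intros continuous_on_tendsto_compose[OF continuous_on_cis[OF continuous_on_id]])
    have "(\<lambda>\<omega>. cis (1 \<bullet> X n \<omega>)) \<in> borel_measurable M" for n by measurable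
    then show "(\<lambda>\<omega>. cis (X n \<omega>)) \<in> borel_measurable M" for n by simp
    have "(\<lambda>\<omega>. cis (1 \<bullet> (a * J \<theta> \<omega> + b * J w \<omega> + v \<bullet> G w \<omega>))) \<in> borel_measurable M" by measurable
    then show "(\<lambda>\<omega>. cis (a * J \<theta> \<omega> + b * J w \<omega> + v \<bullet> G w \<omega>)) \<in> borel_measurable M" by simp
  qed auto
  moreover have "(\<lambda>n. CLINT \<omega>|M. cis (X n \<omega>)) \<longlonglongrightarrow> cis (\<mu> * (a + b)) * exp (- combination_variance ?z a b v / 2)"
    unfolding X_char by (intro tendsto_intros V_lim) simp
  ultimately show ?thesis by (rule LIMSEQ_unique)
qed

section \<open>The conditional mean\<close>

text \<open>
  The best linear predictor of \<open>J \<theta>\<close> from the observation \<open>y = (J w, G w)\<close>.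
\<close>

definition regression :: "'a \<Rightarrow> 'a \<Rightarrow> real \<times> 'a \<Rightarrow> real" where
  "regression w \<theta> y = \<mu> + C ((norm (\<theta> - w))\<^sup>2 / 2) / C 0 * (fst y - \<mu>)
     + C' ((norm (\<theta> - w))\<^sup>2 / 2) / C' 0 * ((\<theta> - w) \<bullet> snd y)"

definition residual :: "'a \<Rightarrow> 'a \<Rightarrow> 'w \<Rightarrow> real" where
  "residual w \<theta> \<omega> = J \<theta> \<omega> - regression w \<theta> (J w \<omega>, G w \<omega>)"

lemma regression_continuous: "continuous_on UNIV (regression w \<theta>)"
  unfolding regression_def by (intro continuous_intros) (use C0_pos in auto)

lemma regression_integrable: "integrable M (\<lambda>\<omega>. regression w \<theta> (J w \<omega>, G w \<omega>))"
  unfolding regression_def by (simp add: J_integrable G_inner_integrable)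

lemma residual_integrable: "integrable M (residual w \<theta>)"
  unfolding residual_def[abs_def]
  by (intro Bochner_Integration.integrable_diff J_integrable regression_integrable)

text \<open>
  The hypotheses are the normal equations of linear regression: they make the mixed terms between
  the residual and the observation vanish, as in the theorem of Pythagoras.
\<close>

lemma combination_variance_orthogonal_split:
  assumes \<alpha>: "C ((norm z)\<^sup>2 / 2) = C 0 * \<alpha>"
    and \<beta>: "\<And>u. C' ((norm z)\<^sup>2 / 2) * (z \<bullet> u) = C' 0 * (\<beta> \<bullet> u)"
  shows "combination_variance z s (b - s * \<alpha>) (v - s *\<^sub>R \<beta>) =
    combination_variance z s (- s * \<alpha>) (- s *\<^sub>R \<beta>) + (b\<^sup>2 * C 0 - C' 0 * (norm v)\<^sup>2)"
proof -
  have expand: "combination_variance z s d u = s\<^sup>2 * C 0 + d\<^sup>2 * C 0 + 2 * s * d * (C 0 * \<alpha>)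
      - 2 * s * (C' 0 * (\<beta> \<bullet> u)) - C' 0 * (u \<bullet> u)" for d u
    unfolding combination_variance_def \<alpha> \<beta>[symmetric] power2_norm_eq_inner[of u] by simp
  show ?thesis
    unfolding power2_norm_eq_inner[of v] expand
    by (simp add: inner_diff_left inner_diff_right inner_commute power2_eq_square algebra_simps)
qed

lemma residual_joint_charfun:
  defines "\<alpha> \<equiv> \<lambda>z. C ((norm z)\<^sup>2 / 2) / C 0" and "\<beta> \<equiv> \<lambda>z. (C' ((norm z)\<^sup>2 / 2) / C' 0) *\<^sub>R z"
  shows "(CLINT \<omega>|M. cis (s * residual w \<theta> \<omega> + (b * J w \<omega> + v \<bullet> G w \<omega>))) =
    exp (- combination_variance (\<theta> - w) s (- s * \<alpha> (\<theta> - w)) (- s *\<^sub>R \<beta> (\<theta> - w)) / 2) *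
    (cis (\<mu> * b) * exp (- (b\<^sup>2 * C 0 - C' 0 * (norm v)\<^sup>2) / 2))"
proof -
  let ?z = "\<theta> - w" and ?a = "\<alpha> (\<theta> - w)" and ?b = "\<beta> (\<theta> - w)"
  have regression: "regression w \<theta> y = \<mu> + ?a * (fst y - \<mu>) + ?b \<bullet> snd y" for y
    by (simp add: regression_def \<alpha>_def \<beta>_def)
  have comb: "s * residual w \<theta> \<omega> + (b * J w \<omega> + v \<bullet> G w \<omega>) =
      s * (?a - 1) * \<mu> + (s * J \<theta> \<omega> + (b - s * ?a) * J w \<omega> + (v - s *\<^sub>R ?b) \<bullet> G w \<omega>)" for \<omega>
    unfolding residual_def regression by (simp add: inner_diff_left algebra_simps)
  have a: "C ((norm ?z)\<^sup>2 / 2) = C 0 * ?a"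
    using C0_pos by (simp add: \<alpha>_def)
  have b: "C' ((norm ?z)\<^sup>2 / 2) * (?z \<bullet> u) = C' 0 * (?b \<bullet> u)" for u
    using C'0_neg by (simp add: \<beta>_def)
  have combination_variance: "combination_variance ?z s (b - s * ?a) (v - s *\<^sub>R ?b) =
      combination_variance ?z s (- s * ?a) (- s *\<^sub>R ?b) + (b\<^sup>2 * C 0 - C' 0 * (norm v)\<^sup>2)"
    by (rule combination_variance_orthogonal_split[OF a b])
  have "(CLINT \<omega>|M. cis (s * residual w \<theta> \<omega> + (b * J w \<omega> + v \<bullet> G w \<omega>))) =
      cis (s * (?a - 1) * \<mu>) *
      (CLINT \<omega>|M. cis (s * J \<theta> \<omega> + (b - s * ?a) * J w \<omega> + (v - s *\<^sub>R ?b) \<bullet> G w \<omega>))"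
    unfolding comb cis_mult[symmetric] by (rule integral_mult_right_zero)
  also have "\<dots> = (cis (s * (?a - 1) * \<mu>) * cis (\<mu> * (s + (b - s * ?a)))) *
      exp (- combination_variance ?z s (b - s * ?a) (v - s *\<^sub>R ?b) / 2)"
    by (simp only: joint_charfun mult.assoc)
  also have "cis (s * (?a - 1) * \<mu>) * cis (\<mu> * (s + (b - s * ?a))) = cis (\<mu> * b)"
    by (simp add: cis_mult algebra_simps)
  also have "exp (- combination_variance ?z s (b - s * ?a) (v - s *\<^sub>R ?b) / 2) =
      exp (- combination_variance ?z s (- s * ?a) (- s *\<^sub>R ?b) / 2) * exp (- (b\<^sup>2 * C 0 - C' 0 * (norm v)\<^sup>2) / 2)"
    unfolding combination_variance by (simp add: exp_add[symmetric] diff_divide_distrib add_divide_distrib)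
  finally show ?thesis by (simp add: mult_ac)
qed

text \<open>
  By \<open>residual_joint_charfun\<close> the joint characteristic function is a function of \<open>s\<close> times a function
  of \<open>(b, v)\<close>, both equal to 1 at 0; setting one argument to 0 isolates the other factor.
\<close>

lemma residual_charfun_factors:
  "(CLINT \<omega>|M. cis (s * residual w \<theta> \<omega> + (b * J w \<omega> + v \<bullet> G w \<omega>))) =
    (CLINT \<omega>|M. cis (s * residual w \<theta> \<omega>)) * (CLINT \<omega>|M. cis (b * J w \<omega> + v \<bullet> G w \<omega>))"
proof -
  have "combination_variance z 0 0 0 = 0" for z by (simp add: combination_variance_def)
  then show ?thesis
    using residual_joint_charfun[where b=b and v=v] residual_joint_charfun[of s, where b=0 and v=0]
      residual_joint_charfun[of 0, where b=b and v=v]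
    by simp
qed

lemma expectation_residual: "expectation (residual w \<theta>) = 0"
proof (rule expectation_eq_0_of_charfun_even)
  show "residual w \<theta> \<in> borel_measurable M"
    using residual_integrable by (rule borel_measurable_integrable)
  have even: "combination_variance z (- s) (- (- s) * x) (- (- s) *\<^sub>R u) = combination_variance z s (- s * x) (- s *\<^sub>R u)" for s z x u
    by (simp add: combination_variance_def)
  show "(CLINT \<omega>|M. cis (s * residual w \<theta> \<omega>)) = (CLINT \<omega>|M. cis (- s * residual w \<theta> \<omega>))" for s
    using residual_joint_charfun[of s, where b=0 and v=0] residual_joint_charfun[of "- s", where b=0 and v=0]
    unfolding even by simp
qed

lemma observation_measurable [measurable]: "(\<lambda>\<omega>. (J w \<omega>, G w \<omega>)) \<in> borel_measurable M"
  by simp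

text \<open>
  The residual is centred and independent of the observation, so its integral over every event of the
  observed sigma-algebra is 0.
\<close>

lemma regression_is_conditional_expectation:
  "AE \<omega> in M. real_cond_exp M (vimage_algebra (space M) (\<lambda>\<omega>'. (J w \<omega>', G w \<omega>')) borel) (J \<theta>) \<omega> =
     regression w \<theta> (J w \<omega>, G w \<omega>)"
proof -
  let ?Y = "\<lambda>\<omega>. (J w \<omega>, G w \<omega>)"
  let ?F = "vimage_algebra (space M) ?Y borel"
  have sets_F: "sets ?F = {?Y -` B \<inter> space M |B. B \<in> sets borel}"
    by (rule sets_vimage_algebra2) simp
  have "subalgebra M ?F"
    using measurable_sets[OF observation_measurable] by (auto simp: subalgebra_def sets_F)
  then interpret finite_measure_subalgebra M ?F
    by unfold_locales
  have reg_meas: "(\<lambda>\<omega>. regression w \<theta> (?Y \<omega>)) \<in> borel_measurable ?F"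
    by (rule measurable_compose[OF measurable_vimage_algebra1])
      (simp_all add: borel_measurable_continuous_onI regression_continuous)
  show ?thesis
  proof (rule real_cond_exp_charact[OF _ J_integrable regression_integrable reg_meas])
    fix A assume "A \<in> sets ?F"
    then obtain B where B: "B \<in> sets borel" and A: "A = ?Y -` B \<inter> space M"
      by (auto simp: sets_F)
    have "A \<in> sets M" unfolding A using B by (rule measurable_sets[OF observation_measurable])
    note int = integrable_mult_indicator[OF this J_integrable, of \<theta>]
      integrable_mult_indicator[OF this regression_integrable, of w \<theta>]
    have "(LINT \<omega>|M. residual w \<theta> \<omega> * indicator B (?Y \<omega>)) = 0"
    proof (rule expectation_centred_indicator_eq_0)
      fix s and v :: "real \<times> 'a"
      show "(CLINT \<omega>|M. cis (s * residual w \<theta> \<omega> + v \<bullet> ?Y \<omega>)) =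
          (CLINT \<omega>|M. cis (s * residual w \<theta> \<omega>)) * (CLINT \<omega>|M. cis (v \<bullet> ?Y \<omega>))"
        using residual_charfun_factors by (cases v) simp
    qed (simp_all add: B residual_integrable expectation_residual)
    also have "(LINT \<omega>|M. residual w \<theta> \<omega> * indicator B (?Y \<omega>)) =
        (LINT \<omega>|M. indicator A \<omega> *\<^sub>R J \<theta> \<omega> - indicator A \<omega> *\<^sub>R regression w \<theta> (?Y \<omega>))"
      by (rule Bochner_Integration.integral_cong)
        (auto simp: A residual_def indicator_def)
    also have "\<dots> = (LINT \<omega>:A|M. J \<theta> \<omega>) - (LINT \<omega>:A|M. regression w \<theta> (?Y \<omega>))"
      unfolding set_lebesgue_integral_def using int by (rule Bochner_Integration.integral_diff)
    finally show "(LINT \<omega>:A|M. J \<theta> \<omega>) = (LINT \<omega>:A|M. regression w \<theta> (?Y \<omega>))" by simp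
  qed
qed

text \<open>
  This is what makes the continuous version of the conditional mean unique. The variances \<open>C 0\<close> and
  \<open>- C' 0\<close> are strictly positive, so the observation is \<open>T Z\<close> for an affine bijection \<open>T\<close> and a
  standard Gaussian vector \<open>Z\<close>.
\<close>

lemma AE_eq_0_imp_eq_0:
  assumes \<psi>: "continuous_on UNIV (\<psi> :: real \<times> 'a \<Rightarrow> real)"
    and AE: "AE \<omega> in M. \<psi> (J w \<omega>, G w \<omega>) = 0"
  shows "\<psi> y = 0"
proof -
  define p q where "p = sqrt (C 0)" and "q = sqrt (- C' 0)"
  have p: "p > 0" "p\<^sup>2 = C 0" and q: "q > 0" "q\<^sup>2 = - C' 0"
    using C0_pos C'0_neg by (simp_all add: p_def q_def)
  define T where "T z = (\<mu> + p * fst z, q *\<^sub>R snd z)" for z :: "real \<times> 'a"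
  define Z where "Z \<omega> = ((J w \<omega> - \<mu>) / p, G w \<omega> /\<^sub>R q)" for \<omega>
  have TZ: "T (Z \<omega>) = (J w \<omega>, G w \<omega>)" for \<omega>
    using p q by (simp add: T_def Z_def)
  have "\<psi> (T z) = 0" for z
  proof (rule AE_std_gaussian_continuous[where \<psi>="\<lambda>z. \<psi> (T z)" and Z=Z])
    show "Z \<in> borel_measurable M" unfolding Z_def[abs_def] by measurable
    show "continuous_on UNIV (\<lambda>z. \<psi> (T z))"
      unfolding T_def by (intro continuous_on_compose2[OF \<psi>] continuous_intros) auto
    show "AE \<omega> in M. \<psi> (T (Z \<omega>)) = 0" using AE by (simp add: TZ)
    fix u :: "real \<times> 'a"
    obtain b v where u: "u = (b, v)" by force
    have "u \<bullet> Z \<omega> = - (b / p * \<mu>) + (0 * J w \<omega> + b / p * J w \<omega> + (v /\<^sub>R q) \<bullet> G w \<omega>)" for \<omega>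
      by (simp add: u Z_def diff_divide_distrib algebra_simps)
    then have "(CLINT \<omega>|M. cis (u \<bullet> Z \<omega>)) =
        (CLINT \<omega>|M. cis (- (b / p * \<mu>)) * cis (0 * J w \<omega> + b / p * J w \<omega> + (v /\<^sub>R q) \<bullet> G w \<omega>))"
      by (simp only: cis_mult)
    also have "\<dots> = cis (- (b / p * \<mu>)) *
        (CLINT \<omega>|M. cis (0 * J w \<omega> + b / p * J w \<omega> + (v /\<^sub>R q) \<bullet> G w \<omega>))"
      by (rule integral_mult_right_zero)
    also have "\<dots> = cis (- (b / p * \<mu>)) * (cis (\<mu> * (0 + b / p)) * exp (- combination_variance (w - w) 0 (b / p) (v /\<^sub>R q) / 2))"
      unfolding joint_charfun ..
    also have "combination_variance (w - w) 0 (b / p) (v /\<^sub>R q) = (norm u)\<^sup>2"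
    proof -
      have "(b / p)\<^sup>2 * C 0 = b\<^sup>2" unfolding p(2)[symmetric] using p(1) by (simp add: power_divide)
      moreover have "C' 0 * (norm (v /\<^sub>R q))\<^sup>2 = - (norm v)\<^sup>2"
      proof -
        have "C' 0 = - q\<^sup>2" using q(2) by simp
        then show ?thesis using q(1) by (simp add: power_mult_distrib power_divide field_simps)
      qed
      moreover have "(norm u)\<^sup>2 = b\<^sup>2 + (norm v)\<^sup>2" by (simp add: u norm_Pair)
      ultimately show ?thesis by (simp add: combination_variance_def)
    qed
    also have "cis (- (b / p * \<mu>)) * (cis (\<mu> * (0 + b / p)) * exp (- (norm u)\<^sup>2 / 2)) = exp (- (norm u)\<^sup>2 / 2)"
      by (simp add: mult.assoc[symmetric] cis_mult mult.commute)
    finally show "(CLINT \<omega>|M. cis (u \<bullet> Z \<omega>)) = exp (- (norm u)\<^sup>2 / 2)" .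
  qed
  from this[of "((fst y - \<mu>) / p, snd y /\<^sub>R q)"] show ?thesis
    using p q by (simp add: T_def)
qed

theorem cond_mean_eq_regression: "cond_mean M J G w \<theta> = regression w \<theta>"
  unfolding cond_mean_def
proof (rule the_equality)
  show "continuous_on UNIV (regression w \<theta>) \<and> (AE \<omega> in M. regression w \<theta> (J w \<omega>, G w \<omega>) =
      real_cond_exp M (vimage_algebra (space M) (\<lambda>\<omega>'. (J w \<omega>', G w \<omega>')) borel) (J \<theta>) \<omega>)"
    using regression_continuous regression_is_conditional_expectation by (auto simp: eq_commute)
next
  fix \<phi>
  assume \<phi>: "continuous_on UNIV \<phi> \<and> (AE \<omega> in M. \<phi> (J w \<omega>, G w \<omega>) =
      real_cond_exp M (vimage_algebra (space M) (\<lambda>\<omega>'. (J w \<omega>', G w \<omega>')) borel) (J \<theta>) \<omega>)"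
  have "\<phi> y - regression w \<theta> y = 0" for y
  proof (rule AE_eq_0_imp_eq_0[of "\<lambda>y. \<phi> y - regression w \<theta> y"])
    show "continuous_on UNIV (\<lambda>y. \<phi> y - regression w \<theta> y)"
      using \<phi> by (intro continuous_intros regression_continuous) simp
    show "AE \<omega> in M. \<phi> (J w \<omega>, G w \<omega>) - regression w \<theta> (J w \<omega>, G w \<omega>) = 0"
      using \<phi>[THEN conjunct2] regression_is_conditional_expectation[of w \<theta>] by eventually_elim simp
  qed
  then show "\<phi> = regression w \<theta>" by (simp add: fun_eq_iff)
qed

end

section \<open>Minimizing along the gradient line\<close>

lemma arg_min_eq_unique_minimizer:
  assumes "has_unique_minimizer f" and "is_arg_min f (\<lambda>_. True) x"
  shows "(ARG_MIN f x. True) = x"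
  using assms unfolding has_unique_minimizer_def arg_min_def by blast

lemma is_arg_min_UNIV_iff: "is_arg_min f (\<lambda>_. True) x \<longleftrightarrow> (\<forall>y. f x \<le> (f y :: real))"
  by (auto simp: is_arg_min_def not_less)

lemma norm_scaled_direction: "g \<noteq> 0 \<Longrightarrow> norm (\<eta> *\<^sub>R (g /\<^sub>R norm g)) = \<bar>\<eta>\<bar>"
  for g :: "'a::real_inner"
  by (simp only: sgn_div_norm[symmetric] norm_scaleR norm_sgn if_False mult_1_right)

lemma inner_scaled_direction: "(\<eta> *\<^sub>R (g /\<^sub>R norm g)) \<bullet> g = \<eta> * norm g"
  for g :: "'a::real_inner"
  by (cases "g = 0") (simp_all add: power2_norm_eq_inner[symmetric] power2_eq_square)

text \<open>
  Among the points at distance \<open>r\<close> from \<open>w\<close>, the term \<open>B r * ((\<theta> - w) \<bullet> g)\<close> is smallest at one of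
  \<open>w - r g / norm g\<close> and \<open>w + r g / norm g\<close>, according to the sign of \<open>B r\<close>. Applied to the minimizer
  itself, this gives a minimizer on the line, which uniqueness identifies with it. Minimizers of \<open>h\<close> correspond to minimizers of \<open>f\<close> on the line, hence \<open>h\<close> has
  exactly one.
\<close>

lemma radial_minimizer_on_gradient_line:
  fixes f :: "'a::real_inner \<Rightarrow> real" and A B :: "real \<Rightarrow> real"
  assumes f: "\<And>\<theta>. f \<theta> = A (norm (\<theta> - w)) + B (norm (\<theta> - w)) * ((\<theta> - w) \<bullet> g)"
    and h: "\<And>\<eta>. f (w - \<eta> *\<^sub>R (g /\<^sub>R norm g)) = h \<eta> + c"
    and g: "g \<noteq> 0"
    and unique: "has_unique_minimizer f"
  shows "has_unique_minimizer h \<and>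
    (ARG_MIN f \<theta>. True) = w - (ARG_MIN h \<eta>. True) *\<^sub>R (g /\<^sub>R norm g)"
proof -
  let ?e = "g /\<^sub>R norm g"
  obtain \<theta> where min: "is_arg_min f (\<lambda>_. True) \<theta>"
    and only: "\<And>\<theta>'. is_arg_min f (\<lambda>_. True) \<theta>' \<Longrightarrow> \<theta>' = \<theta>"
    using unique unfolding has_unique_minimizer_def by blast
  have le: "f \<theta> \<le> f \<theta>'" for \<theta>' using min by (simp add: is_arg_min_UNIV_iff)
  define r where "r = norm (\<theta> - w)"
  have "\<exists>\<eta>. f (w - \<eta> *\<^sub>R ?e) \<le> f \<theta>"
  proof -
    define x where "x = (\<theta> - w) \<bullet> g"
    have x: "\<bar>x\<bar> \<le> r * norm g"
      unfolding x_def r_def by (rule Cauchy_Schwarz_ineq2)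
    have r: "r \<ge> 0" by (simp add: r_def)
    have line: "f (w - \<eta> *\<^sub>R ?e) = A r - B r * (\<eta> * norm g)" if "\<bar>\<eta>\<bar> = r" for \<eta>
    proof -
      have "(w - \<eta> *\<^sub>R ?e) - w = - (\<eta> *\<^sub>R ?e)" by simp
      moreover have "norm (\<eta> *\<^sub>R ?e) = r" using norm_scaled_direction[OF g, of \<eta>] that by simp
      moreover have "(\<eta> *\<^sub>R ?e) \<bullet> g = \<eta> * norm g" by (rule inner_scaled_direction)
      ultimately show ?thesis
        by (simp only: f[of "w - \<eta> *\<^sub>R ?e"] norm_minus_cancel inner_minus_left)
    qed
    have \<theta>: "f \<theta> = A r + B r * x" by (simp add: f[of \<theta>] r_def x_def)
    have "\<bar>B r * x\<bar> \<le> \<bar>B r\<bar> * (r * norm g)"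
      using x by (simp add: abs_mult mult_left_mono)
    then have "A r - \<bar>B r\<bar> * (r * norm g) \<le> f \<theta>" using \<theta> by linarith
    then show ?thesis
      using line[of r] line[of "- r"] r by (cases "B r \<ge> 0") (auto intro: exI[of _ r] exI[of _ "- r"])
  qed
  then obtain \<eta> where "f (w - \<eta> *\<^sub>R ?e) \<le> f \<theta>" ..
  then have "is_arg_min f (\<lambda>_. True) (w - \<eta> *\<^sub>R ?e)"
    using le order_trans unfolding is_arg_min_UNIV_iff by blast
  then have \<eta>: "w - \<eta> *\<^sub>R ?e = \<theta>" by (rule only)
  have min_h: "is_arg_min h (\<lambda>_. True) \<eta>"
    unfolding is_arg_min_UNIV_iff
  proof
    fix \<eta>' show "h \<eta> \<le> h \<eta>'" using le[of "w - \<eta>' *\<^sub>R ?e"] h[of \<eta>] h[of \<eta>'] by (simp only: \<eta>)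
  qed
  have "\<eta>' = \<eta>" if "is_arg_min h (\<lambda>_. True) \<eta>'" for \<eta>'
  proof -
    have "h \<eta>' \<le> h \<eta>" using that by (simp add: is_arg_min_UNIV_iff)
    then have "f (w - \<eta>' *\<^sub>R ?e) \<le> f \<theta>" using h[of \<eta>] h[of \<eta>'] by (simp only: \<eta>)
    then have "is_arg_min f (\<lambda>_. True) (w - \<eta>' *\<^sub>R ?e)"
      using le order_trans unfolding is_arg_min_UNIV_iff by blast
    then have "w - \<eta>' *\<^sub>R ?e = w - \<eta> *\<^sub>R ?e"
      unfolding \<eta> by (rule only)
    then show ?thesis using g by auto
  qed
  with min_h have unique_h: "has_unique_minimizer h"
    unfolding has_unique_minimizer_def by blast
  then show ?thesis
    using arg_min_eq_unique_minimizer[OF unique min] arg_min_eq_unique_minimizer[OF unique_h min_h] \<eta>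
    by simp
qed

theorem theorem4p2:
  fixes M :: "'w measure"
    and J :: "'a::euclidean_space \<Rightarrow> 'w \<Rightarrow> real"
    and G :: "'a \<Rightarrow> 'w \<Rightarrow> 'a"
    and \<mu> :: real
    and C C' :: "real \<Rightarrow> real"
    and w0 :: 'a
  assumes "prob_space M"
    and "isotropic_gaussian M J \<mu> C"
    and "gradient_field M J G"
    and "\<And>r. r \<ge> 0 \<Longrightarrow> (C has_real_derivative C' r) (at r within {0..})"
    and "C 0 > 0"
    and "C' 0 < 0"
  shows "\<forall>\<omega>\<in>space M. \<forall>n.
    (let w = rfd M J G w0 n \<omega>;
         j = J w \<omega>;
         g = G w \<omega>;
         \<eta> = (ARG_MIN (rfd_objective C C' \<mu> j (norm g)) \<eta>. True)
     in g \<noteq> 0 \<longrightarrow>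
        has_unique_minimizer (\<lambda>\<theta>. cond_mean M J G w \<theta> (j, g)) \<longrightarrow>
        has_unique_minimizer (rfd_objective C C' \<mu> j (norm g)) \<and>
        rfd M J G w0 (Suc n) \<omega> = w - \<eta> *\<^sub>R (g /\<^sub>R norm g))"
proof -
  interpret isotropic_gradient_model M J G \<mu> C C'
    using assms by (simp add: isotropic_gradient_model_def isotropic_gradient_model_axioms_def)
  have "has_unique_minimizer (rfd_objective C C' \<mu> j (norm g)) \<and>
      rfd_step M J G w j g =
        w - (ARG_MIN (rfd_objective C C' \<mu> j (norm g)) \<eta>. True) *\<^sub>R (g /\<^sub>R norm g)"
    if g: "g \<noteq> 0" and unique: "has_unique_minimizer (\<lambda>\<theta>. cond_mean M J G w \<theta> (j, g))" for w j g
    unfolding rfd_step_def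
  proof (rule radial_minimizer_on_gradient_line[OF _ _ g unique])
    show "cond_mean M J G w \<theta> (j, g) =
        (\<lambda>r. \<mu> + C (r\<^sup>2 / 2) / C 0 * (j - \<mu>)) (norm (\<theta> - w)) +
        (\<lambda>r. C' (r\<^sup>2 / 2) / C' 0) (norm (\<theta> - w)) * ((\<theta> - w) \<bullet> g)" for \<theta>
      by (simp add: cond_mean_eq_regression regression_def)
    fix \<eta>
    have "(w - \<eta> *\<^sub>R (g /\<^sub>R norm g)) - w = - (\<eta> *\<^sub>R (g /\<^sub>R norm g))" by simp
    note this norm_scaled_direction[OF g, of \<eta>] inner_scaled_direction[of \<eta> g]
    then show "cond_mean M J G w (w - \<eta> *\<^sub>R (g /\<^sub>R norm g)) (j, g) =
        rfd_objective C C' \<mu> j (norm g) \<eta> + \<mu>"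
      unfolding cond_mean_eq_regression regression_def rfd_objective_def
      by (simp only: norm_minus_cancel inner_minus_left power2_abs) simp
  qed
  then show ?thesis by (simp add: Let_def)
qed

end
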